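(* Let the data $n,K,m,Q,E,c,d,\ell,u,p,M,r$ and the function $\phi$ be as in the context. Consider the two optimization problems SLP: minimize $\phi(x,y)$ subject to $(x,y)\in S$, where $$S=\{(x,y)\in\mathbb{R}^m\times\mathbb{R}^m \mid x\ge 0,\ y=M(x+\mu-\nu)+r,\ \ell\le y\le u,\ \mu^T(y-\ell)=0,\ \nu^T(u-y)=0\ \text{for some } \mu\ge 0 \text{ and } \nu\ge 0,\ \mu,\nu\in\mathbb{R}^m\},$$ CVX: minimize $\phi(x,y)$ subject to $(x,y)\in C$, where $$C=\{(x,y)\in\mathbb{R}^m\times\mathbb{R}^m \mid x\ge 0,\ y=Mx+r,\ \ell\le y\le u\}.$$ Suppose that $\ell\le 0$, $u\ge 0$ and $u>r$. Then $\mathrm{MIN}(\mathrm{CVX})\subseteq \mathrm{MIN}(\mathrm{SLP})$. Furthermore, the optimization problem CVX is convex, i.e., $C$ is a convex set and $\phi$ is convex on $C$.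
   Context: All vector inequalities are entrywise (so $u>r$ means $u_i>r_i$ for every $i$). For a problem OP of the form "minimize $f(z)$ subject to $z\in S$", $\mathrm{MIN}(\mathrm{OP})=\{z^*\in S\mid f(z^* )\le f(z)\ \forall z\in S\}$ is its set of global minimizers (possibly empty). Data: $n,K$ are positive integers and $m=nK$. The vectors $q,s,h^0,\underline h,\bar h\in\mathbb{R}^m$ satisfy $q>0$, $s,h^0,\underline h,\bar h\ge 0$, and $h^{\mathrm{tot}}\in\mathbb{R}^n$. $\mathds{1}_K$ is the all-ones vector in $\mathbb{R}^K$ and $\otimes$ is the Kronecker product. Put $$Q=\mathrm{diag}(q),\quad c=Q(h^0-s),\quad \ell=s-\bar h,\quad u=s-\underline h,\quad E=-I_n\otimes \mathds{1}_K^T\in\mathbb{R}^{n\times m},\quad d=h^{\mathrm{tot}}+Es.$$ It is assumed that there exists $\bar y\in\mathbb{R}^m$ with $\ell\le\bar y\le u$ and $E\bar y=d$. Let $p\in\mathbb{R}^m$ and $\phi:\mathbb{R}^m\times\mathbb{R}^m\to\mathbb{R}$, $\phi(x,y)=(x-p)^Ty$. Put $$M=Q^{-1}-Q^{-1}E^T(EQ^{-1}E^T)^{-1}EQ^{-1},\qquad r=Q^{-1}E^T(EQ^{-1}E^T)^{-1}d-Mc.$$ Background: SLP is the reformulation, through the KKT conditions of the lower level problem (with the multiplier of $Ey=d$ eliminated), of the bilevel problem BLP: minimize $(x-p)^Ty$ over $(x,y)$ subject to $x\ge 0$ and $y$ being the unique minimizer of $\frac12 y^TQy+(c-x)^Ty$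 subject to $\ell\le y\le u$, $Ey=d$. *)

theory Defs
  imports "HOL-Analysis.Analysis"
begin

text \<open>
  Throughout, \<open>\<real>\<^sup>n\<close> is \<open>real ^ 'n\<close>, and \<open>\<real>\<^sup>m\<close> with \<open>m = nK\<close> is \<open>real ^ ('n \<times> 'k)\<close>, where
  \<open>CARD('n) = n\<close> and \<open>CARD('k) = K\<close> are positive because types are nonempty.  The index pair
  \<open>(i, k)\<close> stands for position \<open>(i - 1)K + k\<close>, which is how the Kronecker product orders rows
  and columns.

  The library's \<open>\<le>\<close> on vectors is entrywise, but its \<open><\<close> only means \<open>x \<le> y \<and> x \<noteq> y\<close>;
  entrywise strict inequality is therefore always spelled out componentwise.
\<close>

definition diag_mat :: "real ^ 'm \<Rightarrow> real ^ 'm ^ 'm" where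
  "diag_mat v = (\<chi> i j. if i = j then v $ i else 0)"

definition kronecker ::
  "real ^ 'c::finite ^ 'r::finite \<Rightarrow> real ^ 'd::finite ^ 's::finite \<Rightarrow> real ^ ('c \<times> 'd) ^ ('r \<times> 's)" where
  "kronecker A B = (\<chi> i j. A $ fst i $ fst j * B $ snd i $ snd j)"

text \<open>
  The matrix \<open>- I\<^sub>n \<otimes> 1\<^sub>K\<^sup>T\<close>, where \<open>1 :: real ^ 'k\<close> is the all-ones vector.  The row index type
  of the Kronecker product is \<open>'n \<times> 1\<close>, with \<open>1\<close> the one-element type; it is identified
  with \<open>'n\<close>.
\<close>

definition E_mat :: "real ^ ('n::finite \<times> 'k::finite) ^ 'n" where
  "E_mat = - (\<chi> i. kronecker (mat 1 :: real ^ 'n ^ 'n)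
     (rowvector (1 :: real ^ 'k) :: real ^ 'k ^ 1) $ (i, 1))"

lemma E_mat_mult_component:
  fixes y :: "real ^ ('n::finite \<times> 'k::finite)"
  shows "(E_mat *v y) $ i = - (\<Sum>k\<in>UNIV. y $ (i, k))"
proof -
  have "(E_mat *v y) $ i = - (\<Sum>j\<in>UNIV. \<Sum>k\<in>UNIV. if i = j then y $ (j, k) else 0)"
    by (simp add: E_mat_def kronecker_def matrix_vector_mult_def mat_def rowvector_def
        sum_negf[symmetric] sum.cartesian_product UNIV_Times_UNIV[symmetric] del: UNIV_Times_UNIV)
      (auto intro!: sum.cong)
  also have "(\<Sum>j\<in>UNIV. \<Sum>k\<in>UNIV. if i = j then y $ (j, k) else 0)
      = (\<Sum>j\<in>UNIV. if i = j then (\<Sum>k\<in>UNIV. y $ (j, k)) else 0)"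
    by (intro sum.cong refl) simp
  finally show ?thesis by simp
qed

definition minimizers :: "('z \<Rightarrow> real) \<Rightarrow> 'z set \<Rightarrow> 'z set" where
  "minimizers f S = {z \<in> S. \<forall>w\<in>S. f z \<le> f w}"

definition phi :: "real ^ 'm \<Rightarrow> (real ^ 'm) \<times> (real ^ 'm) \<Rightarrow> real" where
  "phi p = (\<lambda>(x, y). (x - p) \<bullet> y)"

definition SLP_set ::
  "real ^ 'm ^ 'm \<Rightarrow> real ^ 'm \<Rightarrow> real ^ 'm \<Rightarrow> real ^ 'm \<Rightarrow> ((real ^ 'm) \<times> (real ^ 'm)) set" where
  "SLP_set M r l u = {(x, y). \<exists>\<mu> \<nu>. \<mu> \<ge> 0 \<and> \<nu> \<ge> 0 \<and>
     x \<ge> 0 \<and> y = M *v (x + \<mu> - \<nu>) + r \<and> l \<le> y \<and> y \<le> u \<and>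
     \<mu> \<bullet> (y - l) = 0 \<and> \<nu> \<bullet> (u - y) = 0}"

definition CVX_set ::
  "real ^ 'm ^ 'm \<Rightarrow> real ^ 'm \<Rightarrow> real ^ 'm \<Rightarrow> real ^ 'm \<Rightarrow> ((real ^ 'm) \<times> (real ^ 'm)) set" where
  "CVX_set M r l u = {(x, y). x \<ge> 0 \<and> y = M *v x + r \<and> l \<le> y \<and> y \<le> u}"

end

theory Submission
  imports Defs
begin

text \<open>
  The matrix \<open>M\<close> acts on each of the \<open>n\<close> blocks separately: it subtracts from the entries of a
  block their mean with weights \<open>1 / q\<close> and then divides by \<open>q\<close> (\<open>projected_inverse_component\<close>).
  Everything rests on two consequences.  At a smallest entry of a block, \<open>M z\<close> is nonpositive
  (\<open>projected_inverse_nonpos_at_block_min\<close>), and \<open>M\<close> is positive semidefinite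
  (\<open>projected_inverse_psd\<close>).

  Let \<open>(x, y)\<close> be feasible for SLP with multipliers \<open>\<mu>\<close>, \<open>\<nu>\<close>, and put \<open>z = x + \<mu> - \<nu>\<close>.  Then
  \<open>z \<ge> 0\<close>.  Otherwise some block has a negative smallest entry \<open>z\<^sub>j\<close>, which forces \<open>\<nu>\<^sub>j > 0\<close> and
  by complementarity \<open>y\<^sub>j = u\<^sub>j > r\<^sub>j\<close>; but \<open>y\<^sub>j - r\<^sub>j\<close> is the entry of \<open>M z\<close> at \<open>j\<close>, which is
  nonpositive.  So \<open>(z, y)\<close> is feasible for CVX.  Passing from \<open>x\<close> to \<open>z\<close> changes the objective by
  \<open>\<mu> \<bullet> y - \<nu> \<bullet> y = \<mu> \<bullet> l - \<nu> \<bullet> u \<le> 0\<close>, because \<open>l \<le> 0 \<le> u\<close>.  Thus every SLP point is matched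
  or beaten by a CVX point, while CVX points are SLP points with \<open>\<mu> = \<nu> = 0\<close>; this gives the
  inclusion of the minimizers.

  On the feasible set of CVX the objective is \<open>(x - p) \<bullet> (M x + r)\<close>, a quadratic function whose
  convexity is the positive semidefiniteness of \<open>M\<close>.
\<close>

section \<open>Diagonal matrices and block sums\<close>

lemma diag_mat_mult_component:
  fixes v x :: "real ^ 'm::finite"
  shows "(diag_mat v *v x) $ i = v $ i * x $ i"
  by (simp add: diag_mat_def matrix_vector_mult_def
      if_distrib[of "\<lambda>a. a * b" for b] cong: if_cong)

lemma matrix_inv_diag_mat:
  fixes v :: "real ^ 'm::finite"
  assumes "\<forall>i. v $ i \<noteq> 0"
  shows "matrix_inv (diag_mat v) = diag_mat (\<chi> i. 1 / v $ i)"
proof -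
  let ?D = "diag_mat (\<chi> i. 1 / v $ i)"
  have "diag_mat v ** ?D = mat 1" and DA: "?D ** diag_mat v = mat 1"
    using assms by (simp_all add: matrix_eq vec_eq_iff diag_mat_mult_component
        flip: matrix_vector_mul_assoc)
  then have "diag_mat v ** matrix_inv (diag_mat v) = mat 1"
    unfolding matrix_inv_def by (metis (mono_tags, lifting) someI_ex)
  then have "?D ** (diag_mat v ** matrix_inv (diag_mat v)) = ?D"
    by simp
  then show ?thesis
    by (simp add: matrix_mul_assoc DA)
qed

lemma transpose_E_mat_mult_component:
  fixes z :: "real ^ 'n::finite"
  shows "(transpose (E_mat :: real ^ ('n \<times> 'k::finite) ^ 'n) *v z) $ (i, k) = - z $ i"
  by (simp del: transpose_matrix_vector
      add: E_mat_def kronecker_def matrix_vector_mult_def mat_def rowvector_def transpose_def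
        sum_negf if_distrib[of "\<lambda>a. a * b" for b] cong: if_cong)

section \<open>Weighted block centering\<close>

definition block_mean ::
  "real ^ ('n::finite \<times> 'k::finite) \<Rightarrow> real ^ ('n \<times> 'k) \<Rightarrow> 'n \<Rightarrow> real" where
  "block_mean q v i = (\<Sum>k\<in>UNIV. v $ (i, k) / q $ (i, k)) / (\<Sum>k\<in>UNIV. 1 / q $ (i, k))"

text \<open>
  This is the matrix \<open>M\<close> of the problem: \<open>Q\<^sup>-\<^sup>1\<close> followed by the projection onto the kernel of \<open>E\<close>
  that is orthogonal for the inner product given by \<open>Q\<close>.
\<close>

definition projected_inverse ::
  "real ^ ('n::finite \<times> 'k::finite) \<Rightarrow> real ^ ('n \<times> 'k) ^ ('n \<times> 'k)" where
  "projected_inverse q = (let Q = diag_mat q; E = E_mat :: real ^ ('n \<times> 'k) ^ 'n in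
     matrix_inv Q - matrix_inv Q ** transpose E **
       matrix_inv (E ** matrix_inv Q ** transpose E) ** E ** matrix_inv Q)"

lemma block_weight_pos:
  fixes q :: "real ^ ('n::finite \<times> 'k::finite)"
  assumes "\<forall>j. q $ j > 0"
  shows "(\<Sum>k\<in>UNIV. 1 / q $ (i, k)) > 0"
  using assms by (intro sum_pos) auto

text \<open>
  Each row of \<open>E\<close> is supported on one block, so \<open>E Q\<^sup>-\<^sup>1 E\<^sup>T\<close> is diagonal, with the total
  weights of the blocks as entries, and its inverse is explicit.
\<close>

lemma projected_inverse_component:
  fixes q v :: "real ^ ('n::finite \<times> 'k::finite)"
  assumes q: "\<forall>j. q $ j > 0"
  shows "(projected_inverse q *v v) $ (i, k) = (v $ (i, k) - block_mean q v i) / q $ (i, k)"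
proof -
  let ?E = "E_mat :: real ^ ('n \<times> 'k) ^ 'n"
  let ?W = "(\<chi> i. \<Sum>k\<in>UNIV. 1 / q $ (i, k)) :: real ^ 'n"
  have Qi: "matrix_inv (diag_mat q) = diag_mat (\<chi> j. 1 / q $ j)"
    using q by (intro matrix_inv_diag_mat) (metis less_irrefl)
  have "?E ** diag_mat (\<chi> j. 1 / q $ j) ** transpose ?E = diag_mat ?W"
    by (simp del: transpose_matrix_vector
        add: matrix_eq vec_eq_iff diag_mat_mult_component E_mat_mult_component
        transpose_E_mat_mult_component sum_negf sum_divide_distrib[symmetric] sum_distrib_right
        flip: matrix_vector_mul_assoc)
  moreover have "matrix_inv (diag_mat ?W) = diag_mat (\<chi> i. 1 / ?W $ i)"
    using block_weight_pos[OF q] by (intro matrix_inv_diag_mat) (simp add: less_imp_neq[symmetric])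
  ultimately show ?thesis
    by (simp del: transpose_matrix_vector
        add: projected_inverse_def Let_def Qi matrix_vector_mult_diff_rdistrib
        diag_mat_mult_component E_mat_mult_component transpose_E_mat_mult_component
        block_mean_def diff_divide_distrib flip: matrix_vector_mul_assoc)
qed

text \<open>
  A weighted mean is at least the smallest of the averaged values, so the deviation from it is
  nonpositive there.
\<close>

lemma projected_inverse_nonpos_at_block_min:
  fixes q z :: "real ^ ('n::finite \<times> 'k::finite)"
  assumes q: "\<forall>j. q $ j > 0"
    and min: "\<forall>k'. z $ (i, k) \<le> z $ (i, k')"
  shows "(projected_inverse q *v z) $ (i, k) \<le> 0"
proof -
  have "z $ (i, k) * (\<Sum>k'\<in>UNIV. 1 / q $ (i, k')) \<le> (\<Sum>k'\<in>UNIV. z $ (i, k') / q $ (i, k'))"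
    unfolding sum_distrib_left
    using q min by (intro sum_mono) (simp add: divide_right_mono less_imp_le)
  then have "z $ (i, k) \<le> block_mean q z i"
    using block_weight_pos[OF q] by (simp add: block_mean_def pos_le_divide_eq)
  moreover have "q $ (i, k) > 0" using q by blast
  ultimately show ?thesis
    by (simp add: projected_inverse_component[OF q] divide_le_0_iff)
qed

text \<open>
  The quadratic form is the weighted sum of the squared deviations from the block means, since the
  weighted deviations in a block add up to zero.
\<close>

lemma projected_inverse_psd:
  fixes q v :: "real ^ ('n::finite \<times> 'k::finite)"
  assumes q: "\<forall>j. q $ j > 0"
  shows "v \<bullet> (projected_inverse q *v v) \<ge> 0"
proof -
  have block: "(\<Sum>k\<in>UNIV. v $ (i, k) * ((v $ (i, k) - block_mean q v i) / q $ (i, k))) \<ge> 0" for i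
  proof -
    let ?a = "block_mean q v i"
    let ?dev = "\<lambda>k. (v $ (i, k) - ?a) / q $ (i, k)"
    have "(\<Sum>k\<in>UNIV. ?dev k)
        = (\<Sum>k\<in>UNIV. v $ (i, k) / q $ (i, k)) - ?a * (\<Sum>k\<in>UNIV. 1 / q $ (i, k))"
      by (simp add: diff_divide_distrib sum_subtractf sum_distrib_left)
    also have "\<dots> = 0"
      using block_weight_pos[OF q, of i] by (simp add: block_mean_def)
    finally have "(\<Sum>k\<in>UNIV. v $ (i, k) * ?dev k)
        = (\<Sum>k\<in>UNIV. v $ (i, k) * ?dev k) - ?a * (\<Sum>k\<in>UNIV. ?dev k)"
      by simp
    also have "\<dots> = (\<Sum>k\<in>UNIV. (v $ (i, k) - ?a)\<^sup>2 / q $ (i, k))"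
      by (simp add: sum_distrib_left power2_eq_square flip: sum_subtractf)
        (simp flip: left_diff_distrib diff_divide_distrib)
    also have "\<dots> \<ge> 0"
      using q by (intro sum_nonneg) (simp add: less_imp_le)
    finally show ?thesis .
  qed
  have "v \<bullet> (projected_inverse q *v v)
      = (\<Sum>i\<in>UNIV. \<Sum>k\<in>UNIV. v $ (i, k) * (projected_inverse q *v v) $ (i, k))"
    by (simp add: inner_vec_def sum.cartesian_product)
  then show ?thesis
    using block by (simp add: projected_inverse_component[OF q] sum_nonneg)
qed

section \<open>Absorbing the multipliers\<close>

text \<open>
  The multipliers can be absorbed into \<open>x\<close> without losing its sign: a negative entry of \<open>x + \<mu> - \<nu>\<close>
  needs an active upper bound, and at a block minimum that bound would lie at or below \<open>r\<close>.
\<close>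

lemma absorbed_multipliers_nonneg:
  fixes q x y \<mu> \<nu> u r :: "real ^ ('n::finite \<times> 'k::finite)"
  assumes q: "\<forall>j. q $ j > 0"
    and u_gt_r: "\<forall>j. u $ j > r $ j"
    and nonneg: "x \<ge> 0" "\<mu> \<ge> 0" "\<nu> \<ge> 0"
    and y: "y = projected_inverse q *v (x + \<mu> - \<nu>) + r" "y \<le> u"
    and compl: "\<nu> \<bullet> (u - y) = 0"
  shows "x + \<mu> - \<nu> \<ge> 0"
proof -
  let ?z = "x + \<mu> - \<nu>"
  have "?z $ (i, k) \<ge> 0" for i k
  proof (rule ccontr)
    assume neg: "\<not> ?z $ (i, k) \<ge> 0"
    obtain k0 where min: "\<forall>k'. ?z $ (i, k0) \<le> ?z $ (i, k')"
    proof -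
      have "Min (range (\<lambda>k. ?z $ (i, k))) \<in> range (\<lambda>k. ?z $ (i, k))"
        by (rule Min_in) auto
      then obtain k0 where k0: "?z $ (i, k0) = Min (range (\<lambda>k. ?z $ (i, k)))"
        by (metis rangeE)
      have "?z $ (i, k0) \<le> ?z $ (i, k')" for k'
        unfolding k0 by (rule Min_le) auto
      with that show thesis by blast
    qed
    have "?z $ (i, k0) < 0"
      using neg min by (metis not_le order_le_less_trans)
    moreover have "x $ (i, k0) \<ge> 0" "\<mu> $ (i, k0) \<ge> 0"
      using nonneg by (auto simp: less_eq_vec_def)
    ultimately have \<nu>_pos: "\<nu> $ (i, k0) > 0" by simp
    have "\<forall>j\<in>UNIV. \<nu> $ j * (u - y) $ j = 0"
      using compl nonneg(3) y(2)
      by (subst sum_nonneg_eq_0_iff[symmetric]) (auto simp: inner_vec_def less_eq_vec_def)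
    with \<nu>_pos have "y $ (i, k0) = u $ (i, k0)"
      by (metis UNIV_I eq_iff_diff_eq_0 less_irrefl mult_eq_0_iff vector_minus_component)
    moreover have "y $ (i, k0) \<le> r $ (i, k0)"
      using projected_inverse_nonpos_at_block_min[OF q min] y(1) by simp
    ultimately show False
      using u_gt_r by (metis not_le)
  qed
  then show ?thesis by (simp add: less_eq_vec_def)
qed

section \<open>Convexity\<close>

lemma convex_CVX_set:
  fixes M :: "real ^ 'm::finite ^ 'm"
  shows "convex (CVX_set M r l u)"
proof (rule convexI, clarify)
  fix x1 y1 x2 y2 and a b :: real
  assume ab: "a \<ge> 0" "b \<ge> 0" "a + b = 1"
    and 1: "(x1, y1) \<in> CVX_set M r l u" and 2: "(x2, y2) \<in> CVX_set M r l u"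
  have "a *\<^sub>R x1 + b *\<^sub>R x2 \<ge> 0"
    using 1 2 ab by (simp add: CVX_set_def less_eq_vec_def)
  moreover have "a *\<^sub>R r + b *\<^sub>R r = r"
    using ab(3) by (metis scaleR_left_distrib scaleR_one)
  then have "a *\<^sub>R y1 + b *\<^sub>R y2 = M *v (a *\<^sub>R x1 + b *\<^sub>R x2) + r"
    using 1 2 by (simp add: CVX_set_def algebra_simps)
  moreover have "a *\<^sub>R y1 + b *\<^sub>R y2 \<in> {l..u}"
    using 1 2 ab unfolding CVX_set_def by (intro convexD[OF convex_closed_interval]) auto
  ultimately show "a *\<^sub>R (x1, y1) + b *\<^sub>R (x2, y2) \<in> CVX_set M r l u"
    by (simp add: CVX_set_def)
qed

text \<open>
  The objective is a bilinear form plus a linear one, so along a segment its convexity defect is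
  \<open>t (1 - t)\<close> times the bilinear form at the difference of the end points.  In this set such a
  difference has the shape \<open>(v, M v)\<close>.
\<close>

lemma convex_on_phi_CVX_set:
  fixes M :: "real ^ 'm::finite ^ 'm"
  assumes psd: "\<And>v. v \<bullet> (M *v v) \<ge> 0"
  shows "convex_on (CVX_set M r l u) (phi p)"
proof (rule convex_onI, clarify)
  fix t :: real and x1 y1 x2 y2
  assume t: "0 < t" "t < 1"
    and 1: "(x1, y1) \<in> CVX_set M r l u" and 2: "(x2, y2) \<in> CVX_set M r l u"
  have "y1 - y2 = M *v (x1 - x2)"
    using 1 2 by (simp add: CVX_set_def matrix_vector_mult_diff_distrib)
  then have "(x1 - x2) \<bullet> (y1 - y2) \<ge> 0"
    using psd by simp
  then have "t * (1 - t) * ((x1 - x2) \<bullet> (y1 - y2)) \<ge> 0"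
    using t by simp
  also have "t * (1 - t) * ((x1 - x2) \<bullet> (y1 - y2))
      = (1 - t) * phi p (x1, y1) + t * phi p (x2, y2)
        - phi p ((1 - t) *\<^sub>R (x1, y1) + t *\<^sub>R (x2, y2))"
    by (simp add: phi_def inner_simps) (simp add: algebra_simps power2_eq_square)
  finally show "phi p ((1 - t) *\<^sub>R (x1, y1) + t *\<^sub>R (x2, y2))
      \<le> (1 - t) * phi p (x1, y1) + t * phi p (x2, y2)"
    by simp
qed (rule convex_CVX_set)

section \<open>Minimizers\<close>

theorem theorem4:
  fixes q s h0 h_lo h_hi c l u r p :: "real ^ ('n::finite \<times> 'k::finite)"
    and h_tot d :: "real ^ 'n"
    and Q M :: "real ^ ('n \<times> 'k) ^ ('n \<times> 'k)"
    and E :: "real ^ ('n \<times> 'k) ^ 'n"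
  assumes q_pos: "\<forall>i. q $ i > 0"
    and nonneg: "s \<ge> 0" "h0 \<ge> 0" "h_lo \<ge> 0" "h_hi \<ge> 0"
    and Q: "Q = diag_mat q"
    and c: "c = Q *v (h0 - s)"
    and l: "l = s - h_hi"
    and u: "u = s - h_lo"
    and E: "E = E_mat"
    and d: "d = h_tot + E *v s"
    and feasible: "\<exists>y. l \<le> y \<and> y \<le> u \<and> E *v y = d"
    and M: "M = matrix_inv Q - matrix_inv Q ** transpose E **
                  matrix_inv (E ** matrix_inv Q ** transpose E) ** E ** matrix_inv Q"
    and r: "r = (matrix_inv Q ** transpose E **
                  matrix_inv (E ** matrix_inv Q ** transpose E)) *v d - M *v c"
    and l_nonpos: "l \<le> 0"
    and u_nonneg: "u \<ge> 0"
    and u_gt_r: "\<forall>i. u $ i > r $ i"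
  shows "minimizers (phi p) (CVX_set M r l u) \<subseteq> minimizers (phi p) (SLP_set M r l u) \<and>
         convex (CVX_set M r l u) \<and> convex_on (CVX_set M r l u) (phi p)"
proof -
  have M_eq: "M = projected_inverse q"
    by (simp add: M Q E projected_inverse_def Let_def)
  have C_sub_S: "CVX_set M r l u \<subseteq> SLP_set M r l u"
    unfolding CVX_set_def SLP_set_def by (auto intro!: exI[of _ 0])
  have dominated: "\<exists>z. (z, y) \<in> CVX_set M r l u \<and> phi p (z, y) \<le> phi p (x, y)"
    if "(x, y) \<in> SLP_set M r l u" for x y
  proof -
    obtain \<mu> \<nu> where S: "\<mu> \<ge> 0" "\<nu> \<ge> 0" "x \<ge> 0" "y = M *v (x + \<mu> - \<nu>) + r" "l \<le> y" "y \<le> u"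
      "\<mu> \<bullet> (y - l) = 0" "\<nu> \<bullet> (u - y) = 0"
      using \<open>(x, y) \<in> SLP_set M r l u\<close> by (auto simp: SLP_set_def)
    have "x + \<mu> - \<nu> \<ge> 0"
      using S M_eq by (intro absorbed_multipliers_nonneg[OF q_pos u_gt_r]) auto
    with S have "(x + \<mu> - \<nu>, y) \<in> CVX_set M r l u"
      by (simp add: CVX_set_def)
    moreover have "\<mu> \<bullet> l \<le> 0"
      using S(1) l_nonpos
      by (auto simp: inner_vec_def less_eq_vec_def intro!: sum_nonpos mult_nonneg_nonpos)
    moreover have "\<nu> \<bullet> u \<ge> 0"
      using S(2) u_nonneg by (auto simp: inner_vec_def less_eq_vec_def intro!: sum_nonneg)
    ultimately show ?thesis
      using S(7,8) by (intro exI[of _ "x + \<mu> - \<nu>"]) (simp add: phi_def inner_simps)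
  qed
  have "minimizers (phi p) (CVX_set M r l u) \<subseteq> minimizers (phi p) (SLP_set M r l u)"
  proof
    fix w assume w: "w \<in> minimizers (phi p) (CVX_set M r l u)"
    have "phi p w \<le> phi p (x, y)" if xy: "(x, y) \<in> SLP_set M r l u" for x y
    proof -
      obtain z where "(z, y) \<in> CVX_set M r l u" "phi p (z, y) \<le> phi p (x, y)"
        using dominated[OF xy] by blast
      with w have "phi p w \<le> phi p (z, y)"
        unfolding minimizers_def by blast
      also note \<open>phi p (z, y) \<le> phi p (x, y)\<close>
      finally show ?thesis .
    qed
    with w C_sub_S show "w \<in> minimizers (phi p) (SLP_set M r l u)"
      unfolding minimizers_def by (auto simp del: split_paired_All)
  qed
  then show ?thesis
    using convex_CVX_set convex_on_phi_CVX_set[OF projected_inverse_psd[OF q_pos]]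
    unfolding M_eq by (intro conjI)
qed

end
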